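(* Let $D$ be a weighted oriented graph, let $U\subseteq V^+(D)$ be the set of vertices of non-trivial weight which are sinks, and let $D'$ be the weighted oriented graph obtained from $D$ by replacing the weight of each vertex of $U$ by $1$. Let $V=V(D)=V(D')=\{x_1,\ldots,x_n\}$, $R=k[x_1,\ldots,x_n]$, and let $\Phi:R\to R$ be the $k$-algebra homomorphism with $\Phi(x_j)=x_j$ if $x_j\notin U$ and $\Phi(x_j)=x_j^{w_j}$ if $x_j\in U$, where $w_j=w(x_j)$ is the weight of $x_j$ in $D$. Let $I=I(D)$ and $\tilde I=I(D')$. Then $\Phi(\tilde I^{\,s})=I^s$ and $\Phi(\tilde I^{(s)})=I^{(s)}$ for all $s\ge1$.
   Context: Let $k$ be a field. A weighted oriented graph $D=(V(D),E(D),w)$ has a finite vertex set $V(D)$, a set $E(D)$ of ordered pairs of distinct vertices ($(x,y)\in E(D)$ is a directed edge from $x$ to $y$), each edge $\{x,y\}$ of the underlying simple graph $G$ carrying exactly one orientation, and a weight function $w:V(D)\to\mathbb N=\{1,2,\dots\}$. A vertex is a source (resp. sink) if it has only outgoing (resp. only incoming) edges; convention: sources have weight $1$. $V^+(D)=\{x:w(x)\ne1\}$ is the set of vertices of non-trivial weight. The edge ideal of $D$ is $I(D)=(x\,y^{w(y)} : (x,y)\in E(D))$ in the polynomial ring $R$ over $k$ whose variables are the vertices of $D$. For $s\ge1$ the $s$-th symbolic power of an ideal $I$ is $I^{(s)}=\bigcap_{P\in\operatorname{Ass}(I)}(I^sR_P\cap R)$, where $\operatorname{Ass}(I)$ is the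 set of associated primes of $R/I$. For an ideal $J\subseteq R$, $\Phi(J)$ denotes the extension of $J$ along $\Phi$, i.e. the ideal of $R$ generated by the image of $J$ under $\Phi$. *)

theory Defs
  imports
    "HOL-Library.Poly_Mapping"
    "HOL-Algebra.Ideal_Product"
    "HOL-Algebra.QuotRing"
    "HOL-Algebra.Algebraic_Closure_Type"
begin

section \<open>Localization of a commutative ring\<close>

definition loc_rel :: "('a, 'b) ring_scheme \<Rightarrow> 'a set \<Rightarrow> (('a \<times> 'a) \<times> ('a \<times> 'a)) set" where
  "loc_rel R S = {((a, s), (b, t)). a \<in> carrier R \<and> s \<in> S \<and> b \<in> carrier R \<and> t \<in> S \<and>
     (\<exists>u\<in>S. u \<otimes>\<^bsub>R\<^esub> (a \<otimes>\<^bsub>R\<^esub> t \<ominus>\<^bsub>R\<^esub> b \<otimes>\<^bsub>R\<^esub> s) = \<zero>\<^bsub>R\<^esub>)}"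

definition loc_frac :: "('a, 'b) ring_scheme \<Rightarrow> 'a set \<Rightarrow> 'a \<Rightarrow> 'a \<Rightarrow> ('a \<times> 'a) set" where
  "loc_frac R S a s = loc_rel R S `` {(a, s)}"

definition localization :: "('a, 'b) ring_scheme \<Rightarrow> 'a set \<Rightarrow> ('a \<times> 'a) set ring" where
  "localization R S = \<lparr>
     carrier = (carrier R \<times> S) // loc_rel R S,
     monoid.mult = (\<lambda>A B. \<Union>(a, s)\<in>A. \<Union>(b, t)\<in>B. loc_frac R S (a \<otimes>\<^bsub>R\<^esub> b) (s \<otimes>\<^bsub>R\<^esub> t)),
     one = loc_frac R S \<one>\<^bsub>R\<^esub> \<one>\<^bsub>R\<^esub>,
     ring.zero = loc_frac R S \<zero>\<^bsub>R\<^esub> \<one>\<^bsub>R\<^esub>,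
     add = (\<lambda>A B. \<Union>(a, s)\<in>A. \<Union>(b, t)\<in>B.
       loc_frac R S (a \<otimes>\<^bsub>R\<^esub> t \<oplus>\<^bsub>R\<^esub> b \<otimes>\<^bsub>R\<^esub> s) (s \<otimes>\<^bsub>R\<^esub> t))\<rparr>"

section \<open>Symbolic powers\<close>

text \<open>The associated primes of the module \<open>R/I\<close>: the prime ideals of \<open>R\<close> that are the
  annihilator of some element of \<open>R/I\<close>.\<close>

definition associated_primes :: "('a, 'b) ring_scheme \<Rightarrow> 'a set \<Rightarrow> 'a set set" where
  "associated_primes R I = {P. primeideal P R \<and>
     (\<exists>m\<in>carrier (R Quot I).
        P = {r \<in> carrier R. (I +>\<^bsub>R\<^esub> r) \<otimes>\<^bsub>R Quot I\<^esub> m = \<zero>\<^bsub>R Quot I\<^esub>})}"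

abbreviation ideal_power :: "('a, 'b) ring_scheme \<Rightarrow> 'a set \<Rightarrow> nat \<Rightarrow> 'a set" where
  "ideal_power R I s \<equiv> I [^]\<^bsub>ideals_set R\<^esub> s"

text \<open>\<open>J R\<^sub>P \<inter> R\<close>, where the intersection means the preimage under \<open>R \<rightarrow> R\<^sub>P\<close>.\<close>

definition local_contraction :: "('a, 'b) ring_scheme \<Rightarrow> 'a set \<Rightarrow> 'a set \<Rightarrow> 'a set" where
  "local_contraction R P J =
     (let S = carrier R - P; \<iota> = (\<lambda>a. loc_frac R S a \<one>\<^bsub>R\<^esub>)
      in {f \<in> carrier R. \<iota> f \<in> Idl\<^bsub>localization R S\<^esub> (\<iota> ` J)})"

definition symbolic_power :: "('a, 'b) ring_scheme \<Rightarrow> 'a set \<Rightarrow> nat \<Rightarrow> 'a set" where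
  "symbolic_power R I s =
     carrier R \<inter> (\<Inter>P\<in>associated_primes R I. local_contraction R P (ideal_power R I s))"

section \<open>Polynomial rings\<close>

text \<open>A monomial is its finitely supported exponent function.\<close>

type_synonym ('v, 'k) mpoly = "('v \<Rightarrow>\<^sub>0 nat) \<Rightarrow>\<^sub>0 'k"

abbreviation mpoly_ring :: "('v, 'k::field) mpoly ring" where
  "mpoly_ring \<equiv> ring_of_type_algebra"

definition Const :: "'k::field \<Rightarrow> ('v, 'k) mpoly" where
  "Const c = Poly_Mapping.single 0 c"

definition Var :: "'v \<Rightarrow> ('v, 'k::field) mpoly" where
  "Var x = Poly_Mapping.single (Poly_Mapping.single x 1) 1"

definition is_algebra_hom :: "(('v, 'k::field) mpoly \<Rightarrow> ('v, 'k) mpoly) \<Rightarrow> bool" where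
  "is_algebra_hom \<Phi> \<longleftrightarrow> \<Phi> \<in> ring_hom mpoly_ring mpoly_ring \<and> (\<forall>c. \<Phi> (Const c) = Const c)"

definition ideal_extension ::
  "(('v, 'k::field) mpoly \<Rightarrow> ('v, 'k) mpoly) \<Rightarrow> ('v, 'k) mpoly set \<Rightarrow> ('v, 'k) mpoly set" where
  "ideal_extension \<Phi> J = Idl\<^bsub>mpoly_ring\<^esub> (\<Phi> ` J)"

section \<open>Weighted oriented graphs\<close>

text \<open>The vertex set is the whole (finite) type \<open>'v\<close>.\<close>

record 'v wograph =
  edges :: "('v \<times> 'v) set"
  weight :: "'v \<Rightarrow> nat"

text \<open>An isolated vertex is vacuously both a source and a sink, so it has weight \<open>1\<close> in a
  weighted oriented graph.\<close>

definition is_source :: "('v, 'z) wograph_scheme \<Rightarrow> 'v \<Rightarrow> bool" where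
  "is_source D x \<longleftrightarrow> (\<forall>(a, b)\<in>edges D. x \<in> {a, b} \<longrightarrow> x = a)"

definition is_sink :: "('v, 'z) wograph_scheme \<Rightarrow> 'v \<Rightarrow> bool" where
  "is_sink D x \<longleftrightarrow> (\<forall>(a, b)\<in>edges D. x \<in> {a, b} \<longrightarrow> x = b)"

definition weighted_oriented_graph :: "('v::finite, 'z) wograph_scheme \<Rightarrow> bool" where
  "weighted_oriented_graph D \<longleftrightarrow>
     (\<forall>x y. (x, y) \<in> edges D \<longrightarrow> x \<noteq> y \<and> (y, x) \<notin> edges D) \<and>
     (\<forall>x. weight D x \<ge> 1) \<and>
     (\<forall>x. is_source D x \<longrightarrow> weight D x = 1)"

definition nontrivial_weight_verts :: "('v, 'z) wograph_scheme \<Rightarrow> 'v set" where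
  "nontrivial_weight_verts D = {x. weight D x \<noteq> 1}"

definition edge_ideal :: "('v::finite, 'z) wograph_scheme \<Rightarrow> ('v, 'k::field) mpoly set" where
  "edge_ideal D = Idl\<^bsub>mpoly_ring\<^esub> {Var x * Var y ^ weight D y | x y. (x, y) \<in> edges D}"

end

theory Submission
  imports Defs
begin

text \<open>
  All ideals involved are monomial, hence given by upward closed sets \<open>M\<close> of exponent vectors.
  Extension along \<open>\<Phi>\<close> is the preimage of \<open>M\<close> under the coordinatewise floor division \<open>q\<close> by the
  exponents of \<open>\<Phi>\<close>. For a monomial ideal, every associated prime lies in an associated prime
  generated by a set \<open>C\<close> of variables that is a colon ideal by a monomial, so the symbolic power is
  the intersection of the saturations of the ordinary power at the variables outside of these
  \<open>C\<close>. Both the family of the sets \<open>C\<close> and the saturations are compatible with preimages under \<open>q\<close>.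
\<close>

section \<open>Commutative rings given by types\<close>

text \<open>The graph contributes two facts: weights are positive, so dividing exponents by them
  makes sense, and a sink is never the tail of an edge, so \<open>\<Phi>\<close> fixes the tail
  variable of every generator and carries the generators for \<open>D'\<close> to those for
  \<open>D\<close>. The obstacle is the symbolic power: extension has to commute with an
  intersection of local contractions taken over the associated primes, embedded ones included, of
  two different ideals. On exponents the extension becomes a preimage, which commutes with
  intersections. The two families of primes agree because an exponent vector with remainder
  \<open>c x - 1\<close> in every coordinate turns each increase of a coordinate into an increase of
  its quotient, while multiplication of exponents by \<open>c\<close> lifts multipliers back without
  a carry.\<close>

lemma ring_of_type_algebra_simps [simp]:
  "carrier (ring_of_type_algebra :: 'a::comm_ring_1 ring) = UNIV"
  "a \<otimes>\<^bsub>ring_of_type_algebra\<^esub> b = a * b"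
  "a \<oplus>\<^bsub>ring_of_type_algebra\<^esub> b = a + b"
  "\<one>\<^bsub>ring_of_type_algebra\<^esub> = (1 :: 'a)"
  "\<zero>\<^bsub>ring_of_type_algebra\<^esub> = (0 :: 'a)"
  by (simp_all add: ring_of_type_algebra_def)

lemma a_minus_ring_of_type_algebra [simp]:
  "a \<ominus>\<^bsub>ring_of_type_algebra\<^esub> b = a - (b :: 'a::comm_ring_1)"
proof -
  interpret cring "ring_of_type_algebra :: 'a ring" by (rule cring_from_type_algebra)
  have "\<ominus>\<^bsub>ring_of_type_algebra\<^esub> b = - b"
    by (rule minus_equality) auto
  then show ?thesis by (simp add: a_minus_def)
qed

text \<open>Negatives are multiples by \<open>\<ominus> \<one>\<close>, and commutativity supplies
  the absorption on the other side.\<close>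

lemma (in cring) idealI_closed:
  assumes "I \<subseteq> carrier R" "\<zero> \<in> I"
    and "\<And>a b. a \<in> I \<Longrightarrow> b \<in> I \<Longrightarrow> a \<oplus> b \<in> I"
    and mult: "\<And>a x. a \<in> I \<Longrightarrow> x \<in> carrier R \<Longrightarrow> x \<otimes> a \<in> I"
  shows "ideal I R"
proof (rule idealI)
  show "ring R" by (rule ring_axioms)
  show "subgroup I (add_monoid R)"
  proof
    fix a assume a: "a \<in> I"
    then have "\<ominus> a = (\<ominus> \<one>) \<otimes> a" using assms(1) by (auto simp: l_minus)
    then have "\<ominus> a \<in> I" using mult[OF a] by simp
    then show "inv\<^bsub>add_monoid R\<^esub> a \<in> I" by (simp add: a_inv_def)
  qed (use assms in auto)
qed (use assms in \<open>auto simp: m_comm subset_iff\<close>)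

lemma ideal_ring_of_type_algebra_iff:
  "ideal I (ring_of_type_algebra :: 'a::comm_ring_1 ring) \<longleftrightarrow>
     0 \<in> I \<and> (\<forall>a\<in>I. \<forall>b\<in>I. a + b \<in> I) \<and> (\<forall>a\<in>I. \<forall>x. x * a \<in> I)"
proof
  interpret cring "ring_of_type_algebra :: 'a ring" by (rule cring_from_type_algebra)
  show "ideal I (ring_of_type_algebra :: 'a ring)"
    if "0 \<in> I \<and> (\<forall>a\<in>I. \<forall>b\<in>I. a + b \<in> I) \<and> (\<forall>a\<in>I. \<forall>x. x * a \<in> I)"
    using that by (intro idealI_closed) auto
next
  assume "ideal I (ring_of_type_algebra :: 'a ring)"
  then interpret ideal I "ring_of_type_algebra :: 'a ring" .
  show "0 \<in> I \<and> (\<forall>a\<in>I. \<forall>b\<in>I. a + b \<in> I) \<and> (\<forall>a\<in>I. \<forall>x. x * a \<in> I)"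
    using additive_subgroup.zero_closed[OF is_additive_subgroup]
      additive_subgroup.a_closed[OF is_additive_subgroup] I_l_closed
    by simp
qed

lemma genideal_type_algebra:
  fixes A :: "'a::comm_ring_1 set"
  shows "ideal (Idl\<^bsub>ring_of_type_algebra\<^esub> A) ring_of_type_algebra"
    and "A \<subseteq> Idl\<^bsub>ring_of_type_algebra\<^esub> A"
    and "ideal J ring_of_type_algebra \<Longrightarrow> A \<subseteq> J \<Longrightarrow> Idl\<^bsub>ring_of_type_algebra\<^esub> A \<subseteq> J"
proof -
  interpret cring "ring_of_type_algebra :: 'a ring" by (rule cring_from_type_algebra)
  show "ideal (Idl\<^bsub>ring_of_type_algebra\<^esub> A) ring_of_type_algebra"
    and "A \<subseteq> Idl\<^bsub>ring_of_type_algebra\<^esub> A"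
    and "ideal J ring_of_type_algebra \<Longrightarrow> A \<subseteq> J \<Longrightarrow> Idl\<^bsub>ring_of_type_algebra\<^esub> A \<subseteq> J"
    by (auto intro: genideal_ideal genideal_self[THEN subsetD] genideal_minimal[THEN subsetD])
qed

text \<open>The unit of the monoid of ideals is the whole ring, so inductions on the exponent start
  from the carrier.\<close>

lemma ideal_power_simps:
  "ideal_power R I 0 = carrier R"
  "ideal_power R I (Suc s) = ideal_power R I s \<cdot>\<^bsub>R\<^esub> I"
  by (simp_all add: nat_pow_def ideals_set_def)

section \<open>Localization and symbolic powers\<close>

locale mult_closed_set =
  fixes S :: "'a::comm_ring_1 set"
  assumes one_mem: "1 \<in> S"
    and mult_mem: "s \<in> S \<Longrightarrow> t \<in> S \<Longrightarrow> s * t \<in> S"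
begin

abbreviation frac :: "'a \<Rightarrow> 'a \<Rightarrow> ('a \<times> 'a) set" where
  "frac \<equiv> loc_frac ring_of_type_algebra S"

abbreviation locring :: "('a \<times> 'a) set ring" where
  "locring \<equiv> localization ring_of_type_algebra S"

lemma loc_rel_iff:
  "((a, s), (b, t)) \<in> loc_rel ring_of_type_algebra S \<longleftrightarrow>
     s \<in> S \<and> t \<in> S \<and> (\<exists>u\<in>S. u * (a * t - b * s) = 0)"
  by (auto simp: loc_rel_def)

lemma equiv_loc_rel: "equiv ((UNIV :: 'a set) \<times> S) (loc_rel ring_of_type_algebra S)"
proof (intro equivI refl_onI symI transI)
  show "loc_rel ring_of_type_algebra S \<subseteq> (UNIV \<times> S) \<times> (UNIV \<times> S)"
    by (auto simp: loc_rel_iff)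
next
  fix p :: "'a \<times> 'a" assume "p \<in> UNIV \<times> S"
  then show "(p, p) \<in> loc_rel ring_of_type_algebra S"
    using one_mem by (cases p) (auto simp: loc_rel_iff)
next
  fix p q assume "(p, q) \<in> loc_rel ring_of_type_algebra S"
  then show "(q, p) \<in> loc_rel ring_of_type_algebra S"
    by (cases p; cases q) (auto simp: loc_rel_iff algebra_simps intro: sym)
next
  fix p q r
  assume pq: "(p, q) \<in> loc_rel ring_of_type_algebra S" and qr: "(q, r) \<in> loc_rel ring_of_type_algebra S"
  obtain a s b t c v where eqs: "p = (a, s)" "q = (b, t)" "r = (c, v)" by (cases p; cases q; cases r)
  obtain u where u: "u \<in> S" "u * (a * t - b * s) = 0" using pq by (auto simp: eqs loc_rel_iff)
  obtain u' where u': "u' \<in> S" "u' * (b * v - c * t) = 0" using qr by (auto simp: eqs loc_rel_iff)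
  \<comment> \<open>The extra factor \<open>t\<close>, the denominator of the middle fraction,
    replaces a cancellation that a general ring does not allow.\<close>
  have "u * u' * t * (a * v - c * s)
      = u' * v * (u * (a * t - b * s)) + u * s * (u' * (b * v - c * t))"
    by (simp add: algebra_simps)
  then have "u * u' * t * (a * v - c * s) = 0" by (simp add: u u')
  moreover have "u * u' * t \<in> S" using u u' pq by (auto simp: eqs loc_rel_iff intro!: mult_mem)
  ultimately show "(p, r) \<in> loc_rel ring_of_type_algebra S"
    using pq qr by (auto simp: eqs loc_rel_iff)
qed

lemma frac_eq_iff:
  assumes "s \<in> S" "t \<in> S"
  shows "frac a s = frac b t \<longleftrightarrow> (\<exists>u\<in>S. u * (a * t - b * s) = 0)"
  using eq_equiv_class_iff[OF equiv_loc_rel, of "(a, s)" "(b, t)"] assms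
  by (simp add: loc_frac_def loc_rel_iff)

lemma frac_eqI: "s \<in> S \<Longrightarrow> t \<in> S \<Longrightarrow> a * t = b * s \<Longrightarrow> frac a s = frac b t"
  using one_mem by (auto simp: frac_eq_iff)

lemma mem_frac_iff: "s \<in> S \<Longrightarrow> (b, t) \<in> frac a s \<longleftrightarrow> t \<in> S \<and> frac b t = frac a s"
  using equiv_class_eq_iff[OF equiv_loc_rel, of "(a, s)" "(b, t)"]
  by (auto simp: loc_frac_def)

lemma carrier_locring: "carrier locring = {frac a s | a s. s \<in> S}"
  by (auto simp: localization_def loc_frac_def quotient_def)

lemma frac_mem_carrier [simp]: "s \<in> S \<Longrightarrow> frac a s \<in> carrier locring"
  by (auto simp: carrier_locring)

text \<open>The operations of the localization are unions over all pairs of representatives. Classes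
  are nonempty, so a union of equal sets collapses to the value at any chosen pair.\<close>

lemma UN_frac:
  assumes "s \<in> S" "t \<in> S"
    and cong: "\<And>a' s' b' t'. s' \<in> S \<Longrightarrow> t' \<in> S \<Longrightarrow> frac a' s' = frac a s \<Longrightarrow> frac b' t' = frac b t \<Longrightarrow>
      F a' s' b' t' = F a s b t"
  shows "(\<Union>(a', s')\<in>frac a s. \<Union>(b', t')\<in>frac b t. F a' s' b' t') = F a s b t"
proof -
  have "frac a s \<noteq> {}" "frac b t \<noteq> {}"
    using assms(1,2) mem_frac_iff by blast+
  moreover have "F a' s' b' t' = F a s b t" if "(a', s') \<in> frac a s" "(b', t') \<in> frac b t" for a' s' b' t'
    using that mem_frac_iff[OF assms(1)] mem_frac_iff[OF assms(2)] cong by metis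
  ultimately show ?thesis
    by (intro SUP_eq_const) (assumption | clarsimp simp only: case_prod_conv | rule SUP_eq_const)+
qed

lemma mult_frac:
  assumes "s \<in> S" "t \<in> S"
  shows "frac a s \<otimes>\<^bsub>locring\<^esub> frac b t = frac (a * b) (s * t)"
proof -
  have "frac (a' * b') (s' * t') = frac (a * b) (s * t)"
    if st: "s' \<in> S" "t' \<in> S" and a: "frac a' s' = frac a s" and b: "frac b' t' = frac b t" for a' s' b' t'
  proof -
    obtain u where u: "u \<in> S" "u * (a' * s - a * s') = 0" using a st assms by (auto simp: frac_eq_iff)
    obtain v where v: "v \<in> S" "v * (b' * t - b * t') = 0" using b st assms by (auto simp: frac_eq_iff)
    \<comment> \<open>Telescoping: the first summand exchanges \<open>a' / s'\<close> for
      \<open>a / s\<close>, the second \<open>b' / t'\<close> for \<open>b / t\<close>.\<close>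
    have "u * v * (a' * b' * (s * t) - a * b * (s' * t'))
        = v * b' * t * (u * (a' * s - a * s')) + u * a * s' * (v * (b' * t - b * t'))"
      by (simp add: algebra_simps)
    then have "u * v * (a' * b' * (s * t) - a * b * (s' * t')) = 0" by (simp add: u v)
    then show ?thesis using u v st assms mult_mem by (auto simp: frac_eq_iff)
  qed
  then show ?thesis using UN_frac[OF assms, where F = "\<lambda>a s b t. frac (a * b) (s * t)" and a = a and b = b]
    by (simp add: localization_def)
qed

lemma add_frac:
  assumes "s \<in> S" "t \<in> S"
  shows "frac a s \<oplus>\<^bsub>locring\<^esub> frac b t = frac (a * t + b * s) (s * t)"
proof -
  have "frac (a' * t' + b' * s') (s' * t') = frac (a * t + b * s) (s * t)"
    if st: "s' \<in> S" "t' \<in> S" and a: "frac a' s' = frac a s" and b: "frac b' t' = frac b t" for a' s' b' t'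
  proof -
    obtain u where u: "u \<in> S" "u * (a' * s - a * s') = 0" using a st assms by (auto simp: frac_eq_iff)
    obtain v where v: "v \<in> S" "v * (b' * t - b * t') = 0" using b st assms by (auto simp: frac_eq_iff)
    have "u * v * ((a' * t' + b' * s') * (s * t) - (a * t + b * s) * (s' * t'))
        = v * t * t' * (u * (a' * s - a * s')) + u * s * s' * (v * (b' * t - b * t'))"
      by (simp add: algebra_simps)
    then have "u * v * ((a' * t' + b' * s') * (s * t) - (a * t + b * s) * (s' * t')) = 0"
      by (simp add: u v)
    then show ?thesis using u v st assms mult_mem by (auto simp: frac_eq_iff)
  qed
  then show ?thesis using UN_frac[OF assms, where F = "\<lambda>a s b t. frac (a * t + b * s) (s * t)" and a = a and b = b]
    by (simp add: localization_def)
qed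

lemma one_locring: "\<one>\<^bsub>locring\<^esub> = frac 1 1" and zero_locring: "\<zero>\<^bsub>locring\<^esub> = frac 0 1"
  by (simp_all add: localization_def)

lemma cring_locring: "cring locring"
proof (intro cringI abelian_groupI comm_monoidI)
  note ops = add_frac mult_frac zero_locring one_locring one_mem mult_mem
  show "\<zero>\<^bsub>locring\<^esub> \<in> carrier locring" "\<one>\<^bsub>locring\<^esub> \<in> carrier locring"
    by (simp_all add: ops)
  fix x assume "x \<in> carrier locring"
  then obtain a s where x: "x = frac a s" "s \<in> S" by (auto simp: carrier_locring)
  show "\<zero>\<^bsub>locring\<^esub> \<oplus>\<^bsub>locring\<^esub> x = x" "\<one>\<^bsub>locring\<^esub> \<otimes>\<^bsub>locring\<^esub> x = x"
    using x by (simp_all add: ops)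
  have "frac (- a) s \<oplus>\<^bsub>locring\<^esub> x = \<zero>\<^bsub>locring\<^esub>"
    unfolding x(1) add_frac[OF x(2) x(2)] zero_locring
    by (rule frac_eqI) (simp_all add: x ops algebra_simps)
  then show "\<exists>y\<in>carrier locring. y \<oplus>\<^bsub>locring\<^esub> x = \<zero>\<^bsub>locring\<^esub>" using x by auto
  fix y assume "y \<in> carrier locring"
  then obtain b t where y: "y = frac b t" "t \<in> S" by (auto simp: carrier_locring)
  show "x \<oplus>\<^bsub>locring\<^esub> y \<in> carrier locring" "x \<otimes>\<^bsub>locring\<^esub> y \<in> carrier locring"
    "x \<oplus>\<^bsub>locring\<^esub> y = y \<oplus>\<^bsub>locring\<^esub> x" "x \<otimes>\<^bsub>locring\<^esub> y = y \<otimes>\<^bsub>locring\<^esub> x"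
    using x y by (simp_all add: ops ac_simps)
  fix z assume "z \<in> carrier locring"
  then obtain c r where z: "z = frac c r" "r \<in> S" by (auto simp: carrier_locring)
  show "x \<oplus>\<^bsub>locring\<^esub> y \<oplus>\<^bsub>locring\<^esub> z = x \<oplus>\<^bsub>locring\<^esub> (y \<oplus>\<^bsub>locring\<^esub> z)"
    "x \<otimes>\<^bsub>locring\<^esub> y \<otimes>\<^bsub>locring\<^esub> z = x \<otimes>\<^bsub>locring\<^esub> (y \<otimes>\<^bsub>locring\<^esub> z)"
    using x y z by (simp_all add: ops algebra_simps)
  \<comment> \<open>The right-hand side is the left-hand one expanded by \<open>r\<close>: the two
    sides of the distributive law have different denominators and agree only as classes.\<close>
  have "frac ((a * t + b * s) * c) (s * t * r)
      = frac (a * c * (t * r) + b * c * (s * r)) (s * r * (t * r))"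
    by (rule frac_eqI) (simp_all add: x y z ops algebra_simps)
  then show "(x \<oplus>\<^bsub>locring\<^esub> y) \<otimes>\<^bsub>locring\<^esub> z = x \<otimes>\<^bsub>locring\<^esub> z \<oplus>\<^bsub>locring\<^esub> y \<otimes>\<^bsub>locring\<^esub> z"
    using x y z by (simp add: ops)
qed

text \<open>The fractions with numerator in \<open>J\<close> already form an ideal of the
  localization, so an element of the generated ideal is a single fraction \<open>j / s\<close>;
  clearing denominators gives the multiplier \<open>u\<close>.\<close>

lemma frac_in_extension_iff:
  assumes J: "ideal J ring_of_type_algebra"
  shows "frac f 1 \<in> Idl\<^bsub>locring\<^esub> ((\<lambda>a. frac a 1) ` J) \<longleftrightarrow> (\<exists>u\<in>S. u * f \<in> J)"
proof
  interpret L: cring locring by (rule cring_locring)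
  note J' = J[unfolded ideal_ring_of_type_algebra_iff]
  let ?K = "{frac j s | j s. j \<in> J \<and> s \<in> S}"
  assume f: "frac f 1 \<in> Idl\<^bsub>locring\<^esub> ((\<lambda>a. frac a 1) ` J)"
  have "ideal ?K locring"
  proof (rule L.idealI_closed)
    show "?K \<subseteq> carrier locring" by (auto simp: carrier_locring)
    show "\<zero>\<^bsub>locring\<^esub> \<in> ?K" using J' one_mem by (auto simp: zero_locring)
    fix x assume "x \<in> ?K"
    then obtain j s where x: "x = frac j s" "j \<in> J" "s \<in> S" by auto
    {
      fix y assume "y \<in> ?K"
      then obtain i t where y: "y = frac i t" "i \<in> J" "t \<in> S" by auto
      have "j * t + i * s \<in> J" using J' x y by (simp add: mult.commute)
      then show "x \<oplus>\<^bsub>locring\<^esub> y \<in> ?K" using x y mult_mem by (auto simp: add_frac)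
    next
      fix y assume "y \<in> carrier locring"
      then obtain i t where y: "y = frac i t" "t \<in> S" by (auto simp: carrier_locring)
      have "i * j \<in> J" using J' x by simp
      then show "y \<otimes>\<^bsub>locring\<^esub> x \<in> ?K" using x y mult_mem by (auto simp: mult_frac)
    }
  qed
  moreover have "(\<lambda>a. frac a 1) ` J \<subseteq> ?K" using one_mem by auto
  ultimately have "frac f 1 \<in> ?K" using f L.genideal_minimal by blast
  then obtain j s where js: "frac f 1 = frac j s" "j \<in> J" "s \<in> S" by auto
  then obtain u where u: "u \<in> S" "u * (f * s - j) = 0" using one_mem by (auto simp: frac_eq_iff)
  then have "u * s * f = u * j" by (simp add: algebra_simps)
  then have "u * s * f \<in> J" using J' js by simp
  then show "\<exists>u\<in>S. u * f \<in> J" using u js mult_mem by auto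
next
  assume "\<exists>u\<in>S. u * f \<in> J"
  then obtain u where u: "u \<in> S" "u * f \<in> J" by auto
  interpret L: cring locring by (rule cring_locring)
  have sub: "(\<lambda>a. frac a 1) ` J \<subseteq> carrier locring" using one_mem by auto
  have "frac 1 u \<otimes>\<^bsub>locring\<^esub> frac (u * f) 1 = frac f 1"
    unfolding mult_frac[OF u(1) one_mem] by (rule frac_eqI) (simp_all add: u one_mem)
  moreover have "frac (u * f) 1 \<in> Idl\<^bsub>locring\<^esub> ((\<lambda>a. frac a 1) ` J)"
    using L.genideal_self[OF sub] u by auto
  ultimately show "frac f 1 \<in> Idl\<^bsub>locring\<^esub> ((\<lambda>a. frac a 1) ` J)"
    using ideal.I_l_closed[OF L.genideal_ideal[OF sub]] u by (metis frac_mem_carrier)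
qed

end

text \<open>Primeness makes the complement of \<open>P\<close> multiplicatively closed. From here on
  fractions are replaced by multipliers outside \<open>P\<close>.\<close>

lemma local_contraction_eq:
  fixes J P :: "'a::comm_ring_1 set"
  assumes J: "ideal J ring_of_type_algebra" and P: "primeideal P ring_of_type_algebra"
  shows "local_contraction ring_of_type_algebra P J = {f. \<exists>u. u \<notin> P \<and> u * f \<in> J}"
proof -
  interpret P: primeideal P "ring_of_type_algebra :: 'a ring" by (rule P)
  interpret mult_closed_set "UNIV - P"
    using P.I_notcarr P.one_imp_carrier P.I_prime by unfold_locales auto
  show ?thesis
    using frac_in_extension_iff[OF J] by (auto simp: local_contraction_def Let_def)
qed

text \<open>Every element of the quotient is the coset of some \<open>g\<close>, and its annihilator
  is the colon ideal of \<open>I\<close> by \<open>g\<close>.\<close>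

lemma associated_primes_eq:
  fixes I :: "'a::comm_ring_1 set"
  assumes "ideal I ring_of_type_algebra"
  shows "associated_primes ring_of_type_algebra I =
    {P. primeideal P ring_of_type_algebra \<and> (\<exists>g. P = {r. r * g \<in> I})}"
proof -
  interpret ideal I "ring_of_type_algebra :: 'a ring" by (rule assms)
  have carr: "carrier (ring_of_type_algebra Quot I) = range (\<lambda>g. I +>\<^bsub>ring_of_type_algebra\<^esub> g)"
    by (auto simp: FactRing_def A_RCOSETS_def')
  have "(I +>\<^bsub>ring_of_type_algebra\<^esub> r) \<otimes>\<^bsub>ring_of_type_algebra Quot I\<^esub> (I +>\<^bsub>ring_of_type_algebra\<^esub> g)
      = \<zero>\<^bsub>ring_of_type_algebra Quot I\<^esub> \<longleftrightarrow> r * g \<in> I" for r g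
  proof -
    have "I +>\<^bsub>ring_of_type_algebra\<^esub> (r * g) = I \<longleftrightarrow> r * g \<in> I"
      using a_rcos_const[of "r * g"] rcos_const_imp_mem[of "r * g"] by fastforce
    then show ?thesis
      using rcoset_mult_add[of r g] by (simp add: FactRing_def)
  qed
  then show ?thesis unfolding associated_primes_def carr by auto
qed

lemma symbolic_power_eq:
  fixes I :: "'a::comm_ring_1 set"
  assumes "ideal (ideal_power ring_of_type_algebra I s) ring_of_type_algebra"
  shows "symbolic_power ring_of_type_algebra I s =
    {f. \<forall>P\<in>associated_primes ring_of_type_algebra I. \<exists>u. u \<notin> P \<and> u * f \<in> ideal_power ring_of_type_algebra I s}"
proof -
  have "primeideal P ring_of_type_algebra" if "P \<in> associated_primes ring_of_type_algebra I" for P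
    using that by (auto simp: associated_primes_def)
  then show ?thesis
    using local_contraction_eq[OF assms] by (auto simp: symbolic_power_def)
qed

section \<open>Monomial ideals\<close>

definition up_closed :: "('v \<Rightarrow>\<^sub>0 nat) set \<Rightarrow> bool" where
  "up_closed M \<longleftrightarrow> (\<forall>m\<in>M. \<forall>k. m + k \<in> M)"

text \<open>Encoded by support instead of by generators, so that intersections and preimages of
  ideals become those of exponent sets. The result is an ideal when \<open>M\<close> is upward
  closed.\<close>

definition monomial_ideal :: "('v \<Rightarrow>\<^sub>0 nat) set \<Rightarrow> ('v, 'k::field) mpoly set" where
  "monomial_ideal M = {f. Poly_Mapping.keys f \<subseteq> M}"

text \<open>The monomials of the prime ideal generated by the variables in \<open>C\<close>.\<close>

definition meets :: "'v set \<Rightarrow> ('v \<Rightarrow>\<^sub>0 nat) set" where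
  "meets C = {m. \<exists>x\<in>C. Poly_Mapping.lookup m x \<noteq> 0}"

text \<open>The multipliers \<open>k\<close> are the monomials outside the prime of
  \<open>C\<close>, that is, those in the variables outside \<open>C\<close>.\<close>

definition saturation :: "'v set \<Rightarrow> ('v \<Rightarrow>\<^sub>0 nat) set \<Rightarrow> ('v \<Rightarrow>\<^sub>0 nat) set" where
  "saturation C N = {m. \<exists>k. k \<notin> meets C \<and> m + k \<in> N}"

text \<open>The sets \<open>C\<close> for which the prime generated by the variables in \<open>C\<close> is the colon of the monomial
  ideal of \<open>M\<close> by a monomial.\<close>

definition prime_supports :: "('v \<Rightarrow>\<^sub>0 nat) set \<Rightarrow> 'v set set" where
  "prime_supports M = {C. \<exists>b. \<forall>k. b + k \<in> M \<longleftrightarrow> k \<in> meets C}"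

lemma up_closedD: "up_closed M \<Longrightarrow> m \<in> M \<Longrightarrow> m + k \<in> M"
  by (auto simp: up_closed_def)

lemma meets_add_iff: "a + b \<in> meets C \<longleftrightarrow> a \<in> meets C \<or> b \<in> meets C"
  by (auto simp: meets_def lookup_add)

lemma up_closed_meets: "up_closed (meets C)"
  by (auto simp: up_closed_def meets_add_iff)

lemma up_closed_saturation: "up_closed N \<Longrightarrow> up_closed (saturation C N)"
  unfolding up_closed_def saturation_def
  by (smt (verit, ccfv_threshold) add.assoc add.commute mem_Collect_eq)

lemma single_mem_monomial_ideal: "m \<in> M \<Longrightarrow> Poly_Mapping.single m c \<in> monomial_ideal M"
  by (auto simp: monomial_ideal_def)

lemma ideal_monomial_ideal:
  assumes "up_closed M"
  shows "ideal (monomial_ideal M :: ('v, 'k::field) mpoly set) mpoly_ring"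
  unfolding ideal_ring_of_type_algebra_iff
proof (intro conjI ballI allI)
  show "0 \<in> monomial_ideal M" by (simp add: monomial_ideal_def)
next
  fix f g :: "('v, 'k) mpoly" assume "f \<in> monomial_ideal M" "g \<in> monomial_ideal M"
  then show "f + g \<in> monomial_ideal M"
    using keys_add[of f g] by (auto simp: monomial_ideal_def)
next
  fix f g :: "('v, 'k) mpoly" assume "f \<in> monomial_ideal M"
  then have "a + b \<in> M" if "b \<in> Poly_Mapping.keys f" for a b
    using that up_closedD[OF assms, of b a] by (auto simp: monomial_ideal_def add.commute)
  then show "g * f \<in> monomial_ideal M"
    using keys_mult[of g f] by (fastforce simp: monomial_ideal_def)
qed

lemma sum_single_lookup:
  "(\<Sum>m\<in>Poly_Mapping.keys f. Poly_Mapping.single m (Poly_Mapping.lookup f m)) = f"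
  by (rule poly_mapping_eqI)
    (simp add: lookup_sum lookup_single when_def sum.delta not_in_keys_iff_lookup_eq_zero)

text \<open>A polynomial is the finite sum of its terms, and each term is a constant times a
  monomial.\<close>

lemma monomial_ideal_subset_iff:
  fixes J :: "('v, 'k::field) mpoly set"
  assumes "ideal J mpoly_ring"
  shows "monomial_ideal M \<subseteq> J \<longleftrightarrow> (\<forall>m\<in>M. Poly_Mapping.single m 1 \<in> J)"
proof
  assume "monomial_ideal M \<subseteq> J"
  then show "\<forall>m\<in>M. Poly_Mapping.single m 1 \<in> J" using single_mem_monomial_ideal by blast
next
  note J = assms[unfolded ideal_ring_of_type_algebra_iff]
  assume single: "\<forall>m\<in>M. Poly_Mapping.single m 1 \<in> J"
  show "monomial_ideal M \<subseteq> J"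
  proof
    fix f :: "('v, 'k) mpoly" assume f: "f \<in> monomial_ideal M"
    have terms: "Poly_Mapping.single m c \<in> J" if "m \<in> M" for m c
    proof -
      have "Poly_Mapping.single 0 c * Poly_Mapping.single m 1 \<in> J" using J single that by blast
      then show ?thesis by (simp add: mult_single)
    qed
    have sums: "sum h A \<in> J" if "finite A" "\<And>a. a \<in> A \<Longrightarrow> h a \<in> J"
      for h :: "('v \<Rightarrow>\<^sub>0 nat) \<Rightarrow> ('v, 'k) mpoly" and A
      using that J by (induction A) auto
    have "(\<Sum>m\<in>Poly_Mapping.keys f. Poly_Mapping.single m (Poly_Mapping.lookup f m)) \<in> J"
      using f by (intro sums terms) (auto simp: monomial_ideal_def)
    then show "f \<in> J" by (simp add: sum_single_lookup)
  qed
qed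

lemma genideal_monomials:
  fixes E :: "('v \<Rightarrow>\<^sub>0 nat) set"
  shows "Idl\<^bsub>mpoly_ring\<^esub> ((\<lambda>e. Poly_Mapping.single e (1 :: 'k::field)) ` E)
    = monomial_ideal {e + k | e k. e \<in> E}" (is "?I = monomial_ideal ?M")
proof
  have up: "up_closed ?M" by (auto simp: up_closed_def) (metis add.assoc)
  have "e \<in> ?M" if "e \<in> E" for e using that by (metis (mono_tags, lifting) add.right_neutral mem_Collect_eq)
  then show "?I \<subseteq> monomial_ideal ?M"
    by (intro genideal_type_algebra(3) ideal_monomial_ideal up)
      (auto intro!: single_mem_monomial_ideal)
  note I = genideal_type_algebra(1,2)[of "(\<lambda>e. Poly_Mapping.single e (1 :: 'k)) ` E"]
  have "Poly_Mapping.single (e + k) 1 \<in> ?I" if "e \<in> E" for e k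
  proof -
    have "Poly_Mapping.single k 1 * Poly_Mapping.single e 1 \<in> ?I"
      using I that unfolding ideal_ring_of_type_algebra_iff by blast
    then show ?thesis by (simp add: mult_single add.commute)
  qed
  then show "monomial_ideal ?M \<subseteq> ?I"
    unfolding monomial_ideal_subset_iff[OF I(1)] by blast
qed

lemma ideal_prod_monomial_ideal:
  assumes "up_closed A" "up_closed B"
  shows "(monomial_ideal A :: ('v, 'k::field) mpoly set) \<cdot>\<^bsub>mpoly_ring\<^esub> monomial_ideal B
    = monomial_ideal {a + b | a b. a \<in> A \<and> b \<in> B}" (is "?P = monomial_ideal ?M")
proof
  have up: "up_closed ?M" using assms by (auto simp: up_closed_def) (metis add.assoc)
  show "?P \<subseteq> monomial_ideal ?M"
  proof
    fix f assume "f \<in> ?P"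
    then show "f \<in> monomial_ideal ?M"
    proof induction
      case (prod i j)
      then show ?case using keys_mult[of i j] by (fastforce simp: monomial_ideal_def)
    next
      case (sum s1 s2)
      then show ?case
        using ideal_monomial_ideal[OF up, where 'k = 'k] by (simp add: ideal_ring_of_type_algebra_iff)
    qed
  qed
  have "ideal ?P mpoly_ring"
    by (intro ring.ideal_prod_is_ideal ring_from_type_algebra ideal_monomial_ideal assms)
  moreover have "Poly_Mapping.single (a + b) 1 \<in> ?P" if "a \<in> A" "b \<in> B" for a b
    using ideal_prod.prod[OF single_mem_monomial_ideal[OF that(1)] single_mem_monomial_ideal[OF that(2)],
        of mpoly_ring 1 1] by (simp add: mult_single)
  ultimately show "monomial_ideal ?M \<subseteq> ?P"
    by (auto simp: monomial_ideal_subset_iff)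
qed

text \<open>The exponent set stays abstract: the later arguments refer to it only through upward
  closedness and the ideal it represents.\<close>

lemma ideal_power_monomial_ideal:
  assumes "up_closed M"
  shows "\<exists>N. up_closed N \<and>
    ideal_power mpoly_ring (monomial_ideal M :: ('v, 'k::field) mpoly set) s = monomial_ideal N"
proof (induction s)
  case 0
  have "ideal_power mpoly_ring (monomial_ideal M :: ('v, 'k) mpoly set) 0 = monomial_ideal UNIV"
    unfolding ideal_power_simps by (simp add: monomial_ideal_def)
  then show ?case by (intro exI[of _ UNIV]) (simp add: up_closed_def)
next
  case (Suc s)
  then obtain N where N: "up_closed N"
    "ideal_power mpoly_ring (monomial_ideal M :: ('v, 'k) mpoly set) s = monomial_ideal N" by auto
  have "up_closed {a + b | a b. a \<in> N \<and> b \<in> M}"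
    using assms by (auto simp: up_closed_def) (metis add.assoc)
  then show ?case
    using ideal_prod_monomial_ideal[OF N(1) assms, where 'k = 'k] N(2) unfolding ideal_power_simps by auto
qed

section \<open>Saturation and associated primes of monomial ideals\<close>

lemma minimal_elements:
  fixes h :: "'a \<Rightarrow> nat"
  assumes "finite A" "A \<noteq> {}"
  shows "{a \<in> A. \<forall>a'\<in>A. h a \<le> h a'} \<noteq> {}"
  using ex_has_least_nat[of "\<lambda>a. a \<in> A" _ h] assms by blast

text \<open>Minimising the coordinates one after the other replaces a monomial order, which would need a
  linear order on the variables.\<close>

lemma unique_sum_on:
  fixes A B :: "('v \<Rightarrow>\<^sub>0 nat) set"
  assumes "finite Y" "finite A" "A \<noteq> {}" "finite B" "B \<noteq> {}"
  shows "\<exists>a\<in>A. \<exists>b\<in>B. \<forall>a'\<in>A. \<forall>b'\<in>B. a' + b' = a + b \<longrightarrow>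
    (\<forall>x\<in>Y. Poly_Mapping.lookup a' x = Poly_Mapping.lookup a x \<and>
            Poly_Mapping.lookup b' x = Poly_Mapping.lookup b x)"
  using assms
proof (induction Y arbitrary: A B)
  case empty
  then show ?case by auto
next
  case (insert x Y)
  define min_at where "min_at S =
    {a \<in> S. \<forall>a'\<in>S. Poly_Mapping.lookup a x \<le> Poly_Mapping.lookup a' x}" for S :: "('v \<Rightarrow>\<^sub>0 nat) set"
  have "min_at A \<noteq> {}" "min_at B \<noteq> {}"
    unfolding min_at_def using insert.prems by (intro minimal_elements; simp)+
  moreover have "finite (min_at A)" "finite (min_at B)" using insert.prems by (auto simp: min_at_def)
  ultimately obtain a b where ab: "a \<in> min_at A" "b \<in> min_at B"
    and uniq: "\<And>a' b'. a' \<in> min_at A \<Longrightarrow> b' \<in> min_at B \<Longrightarrow> a' + b' = a + b \<Longrightarrow>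
      \<forall>x\<in>Y. Poly_Mapping.lookup a' x = Poly_Mapping.lookup a x \<and>
            Poly_Mapping.lookup b' x = Poly_Mapping.lookup b x"
    using insert.IH[of "min_at A" "min_at B"] by blast
  show ?case
  proof (intro bexI ballI impI)
    show "a \<in> A" "b \<in> B" using ab by (auto simp: min_at_def)
    fix a' b' y assume *: "a' \<in> A" "b' \<in> B" "a' + b' = a + b" "y \<in> insert x Y"
    have "Poly_Mapping.lookup a' x + Poly_Mapping.lookup b' x
        = Poly_Mapping.lookup a x + Poly_Mapping.lookup b x"
      using *(3) by (metis lookup_add)
    moreover have "Poly_Mapping.lookup a x \<le> Poly_Mapping.lookup a' x"
      "Poly_Mapping.lookup b x \<le> Poly_Mapping.lookup b' x"
      using ab * by (auto simp: min_at_def)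
    \<comment> \<open>Two lower bounds whose sum is attained are both attained. A competing pair
      with the same sum therefore consists of minimisers, to which \<open>uniq\<close>
      applies.\<close>
    ultimately have eq: "Poly_Mapping.lookup a' x = Poly_Mapping.lookup a x"
      "Poly_Mapping.lookup b' x = Poly_Mapping.lookup b x" by linarith+
    then have "a' \<in> min_at A" "b' \<in> min_at B" using ab * by (auto simp: min_at_def)
    then show "Poly_Mapping.lookup a' y = Poly_Mapping.lookup a y \<and>
        Poly_Mapping.lookup b' y = Poly_Mapping.lookup b y"
      using uniq * eq by auto
  qed
qed

text \<open>No other pair of terms contributes to the coefficient at \<open>a + b\<close>, which is
  thus a product of two nonzero elements of a field.\<close>

lemma unique_sum_mem_keys_mult:
  fixes f g :: "('v, 'k::field) mpoly"
  assumes a: "a \<in> Poly_Mapping.keys f" and b: "b \<in> Poly_Mapping.keys g"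
    and uniq: "\<And>a' b'. a' \<in> Poly_Mapping.keys f \<Longrightarrow> b' \<in> Poly_Mapping.keys g \<Longrightarrow>
      a' + b' = a + b \<Longrightarrow> a' = a \<and> b' = b"
  shows "a + b \<in> Poly_Mapping.keys (f * g)"
proof -
  define f' where "f' = f - Poly_Mapping.single a (Poly_Mapping.lookup f a)"
  define g' where "g' = g - Poly_Mapping.single b (Poly_Mapping.lookup g b)"
  have keys: "Poly_Mapping.keys f' \<subseteq> Poly_Mapping.keys f - {a}"
    "Poly_Mapping.keys g' \<subseteq> Poly_Mapping.keys g - {b}"
    by (auto simp: f'_def g'_def in_keys_iff lookup_minus lookup_single when_def split: if_splits)
  \<comment> \<open>In the middle summand the first exponent is fixed to \<open>a\<close>, so
    cancellation rules out \<open>a + b\<close>; \<open>uniq\<close> is spent on the last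
    summand.\<close>
  have "f * g = Poly_Mapping.single (a + b) (Poly_Mapping.lookup f a * Poly_Mapping.lookup g b)
      + Poly_Mapping.single a (Poly_Mapping.lookup f a) * g' + f' * g"
    by (simp add: f'_def g'_def algebra_simps mult_single)
  moreover have "a + b \<notin> Poly_Mapping.keys (Poly_Mapping.single a (Poly_Mapping.lookup f a) * g')"
    using keys_mult[of "Poly_Mapping.single a (Poly_Mapping.lookup f a)" g'] keys
    by (fastforce split: if_splits)
  moreover have "a + b \<notin> Poly_Mapping.keys (f' * g)"
  proof
    assume "a + b \<in> Poly_Mapping.keys (f' * g)"
    then obtain a' b' where "a' \<in> Poly_Mapping.keys f'" "b' \<in> Poly_Mapping.keys g" "a + b = a' + b'"
      using keys_mult[of f' g] by blast
    then show False using uniq[of a' b'] keys by auto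
  qed
  ultimately have "Poly_Mapping.lookup (f * g) (a + b) = Poly_Mapping.lookup f a * Poly_Mapping.lookup g b"
    by (simp add: lookup_add in_keys_iff)
  then show ?thesis using a b by (simp add: in_keys_iff)
qed

text \<open>The degree \<open>d\<close> in the variables of \<open>C\<close> is additive. Hence a
  pair of terms with the same sum as two terms of least degree also has least degrees, and a sum
  that is unique among these is unique among all pairs.\<close>

lemma minimal_degree_mem_keys_mult:
  fixes f g :: "('v::finite, 'k::field) mpoly" and C :: "'v set"
  assumes "f \<noteq> 0" "g \<noteq> 0"
  defines "d \<equiv> \<lambda>m. \<Sum>x\<in>C. Poly_Mapping.lookup m x"
  obtains a b where "a \<in> Poly_Mapping.keys f" "b \<in> Poly_Mapping.keys g"
    "a + b \<in> Poly_Mapping.keys (f * g)" "\<And>a'. a' \<in> Poly_Mapping.keys f \<Longrightarrow> d a \<le> d a'"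
proof -
  define mins where "mins h = {a \<in> Poly_Mapping.keys h. \<forall>a'\<in>Poly_Mapping.keys h. d a \<le> d a'}"
    for h :: "('v, 'k) mpoly"
  have "Poly_Mapping.keys f \<noteq> {}" "Poly_Mapping.keys g \<noteq> {}" using assms(1,2) by simp_all
  then have "mins f \<noteq> {}" "mins g \<noteq> {}"
    unfolding mins_def by (intro minimal_elements; simp)+
  moreover have "finite (mins f)" "finite (mins g)" by (auto simp: mins_def)
  ultimately obtain a b where ab: "a \<in> mins f" "b \<in> mins g"
    and uniq: "\<forall>a'\<in>mins f. \<forall>b'\<in>mins g. a' + b' = a + b \<longrightarrow>
      (\<forall>x\<in>UNIV. Poly_Mapping.lookup a' x = Poly_Mapping.lookup a x \<and>
            Poly_Mapping.lookup b' x = Poly_Mapping.lookup b x)"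
    using unique_sum_on[OF finite_UNIV, of "mins f" "mins g"] by blast
  have d_add: "d (m + n) = d m + d n" for m n by (simp add: d_def lookup_add sum.distrib)
  have "a + b \<in> Poly_Mapping.keys (f * g)"
  proof (rule unique_sum_mem_keys_mult)
    show "a \<in> Poly_Mapping.keys f" "b \<in> Poly_Mapping.keys g" using ab by (auto simp: mins_def)
    fix a' b' assume *: "a' \<in> Poly_Mapping.keys f" "b' \<in> Poly_Mapping.keys g" "a' + b' = a + b"
    have "d a' + d b' = d a + d b" using *(3) by (metis d_add)
    moreover have "d a \<le> d a'" "d b \<le> d b'" using ab * by (auto simp: mins_def)
    ultimately have "d a' = d a" "d b' = d b" by linarith+
    then have "a' \<in> mins f" "b' \<in> mins g" using ab * by (auto simp: mins_def)
    then show "a' = a \<and> b' = b" using uniq *(3) by (auto intro!: poly_mapping_eqI)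
  qed
  then show thesis using ab that by (auto simp: mins_def)
qed

text \<open>Let \<open>f0\<close> collect the terms of \<open>f\<close> outside the saturation. If
  \<open>f0\<close> is nonzero, some product of a monomial of \<open>u\<close> avoiding
  \<open>C\<close> with a monomial of \<open>f0\<close> survives in \<open>u * f0\<close>; it lies
  in the saturation, and absorbing its first factor into the multiplier puts the second one there as
  well. Primality, colon ideals by monomials and local contractions are all derived from this
  cancellation.\<close>

lemma saturation_cancel:
  fixes u f :: "('v::finite, 'k::field) mpoly"
  assumes N: "up_closed N" and u: "u \<notin> monomial_ideal (meets C)" and uf: "u * f \<in> monomial_ideal N"
  shows "f \<in> monomial_ideal (saturation C N)"
proof (rule ccontr)
  let ?N = "saturation C N"
  assume "f \<notin> monomial_ideal ?N"
  define f1 where "f1 = (\<Sum>m\<in>Poly_Mapping.keys f \<inter> ?N. Poly_Mapping.single m (Poly_Mapping.lookup f m))"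
  define f0 where "f0 = f - f1"
  have lookup_f1: "Poly_Mapping.lookup f1 m = (if m \<in> ?N then Poly_Mapping.lookup f m else 0)" for m
    by (simp add: f1_def lookup_sum lookup_single when_def sum.delta not_in_keys_iff_lookup_eq_zero)
  have f1: "f1 \<in> monomial_ideal ?N"
    by (auto simp: monomial_ideal_def in_keys_iff lookup_f1 split: if_splits)
  have f0: "Poly_Mapping.keys f0 \<inter> ?N = {}"
    by (auto simp: f0_def in_keys_iff lookup_minus lookup_f1)
  have "f0 \<noteq> 0" using f1 \<open>f \<notin> monomial_ideal ?N\<close> by (auto simp: f0_def)
  moreover have "u \<noteq> 0" using u by (auto simp: monomial_ideal_def)
  ultimately obtain a b where ab: "a \<in> Poly_Mapping.keys u" "b \<in> Poly_Mapping.keys f0"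
    "a + b \<in> Poly_Mapping.keys (u * f0)"
    and min: "\<And>a'. a' \<in> Poly_Mapping.keys u \<Longrightarrow>
      (\<Sum>x\<in>C. Poly_Mapping.lookup a x) \<le> (\<Sum>x\<in>C. Poly_Mapping.lookup a' x)"
    using minimal_degree_mem_keys_mult[where C = C] by metis
  obtain a' where "a' \<in> Poly_Mapping.keys u" "a' \<notin> meets C" using u by (auto simp: monomial_ideal_def)
  \<comment> \<open>Some monomial of \<open>u\<close> avoids \<open>C\<close> and has degree
    \<open>0\<close> in its variables, so the least degree is \<open>0\<close>.\<close>
  then have "(\<Sum>x\<in>C. Poly_Mapping.lookup a x) = 0"
    using min[of a'] by (simp add: meets_def)
  then have a: "a \<notin> meets C" by (simp add: meets_def)
  have "N \<subseteq> ?N" by (auto simp: saturation_def meets_def intro!: exI[of _ 0])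
  then have "u * f \<in> monomial_ideal ?N" using uf by (auto simp: monomial_ideal_def)
  moreover have "u * f = u * f0 + u * f1" by (simp add: f0_def algebra_simps)
  moreover note I = ideal_monomial_ideal[OF up_closed_saturation[OF N], of C, where 'k = 'k,
      unfolded ideal_ring_of_type_algebra_iff]
  \<comment> \<open>The difference \<open>u * f - u * f1\<close> is written with sums and multiples
    only, the operations of the ideal criterion.\<close>
  ultimately have "u * f0 + (u * f1 + (- 1) * (u * f1)) \<in> monomial_ideal ?N"
    using f1 by (metis (no_types, lifting) add.assoc)
  then have "u * f0 \<in> monomial_ideal ?N" by simp
  then have "a + b \<in> ?N" using ab by (auto simp: monomial_ideal_def)
  then obtain k where "k \<notin> meets C" "a + b + k \<in> N" by (auto simp: saturation_def)
  then have "b \<in> ?N" using a by (auto simp: saturation_def meets_add_iff ac_simps intro!: exI[of _ "a + k"])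
  then show False using ab f0 by auto
qed

lemma saturation_eq:
  fixes N :: "('v::finite \<Rightarrow>\<^sub>0 nat) set"
  assumes N: "up_closed N"
  shows "{f :: ('v, 'k::field) mpoly. \<exists>u. u \<notin> monomial_ideal (meets C) \<and> u * f \<in> monomial_ideal N}
    = monomial_ideal (saturation C N)"
proof (intro equalityI subsetI)
  fix f :: "('v, 'k) mpoly"
  assume "f \<in> {f. \<exists>u. u \<notin> monomial_ideal (meets C) \<and> u * f \<in> monomial_ideal N}"
  then show "f \<in> monomial_ideal (saturation C N)" using saturation_cancel[OF N] by blast
next
  fix f :: "('v, 'k) mpoly"
  assume f: "f \<in> monomial_ideal (saturation C N)"
  then have "\<forall>m\<in>Poly_Mapping.keys f. \<exists>k. k \<notin> meets C \<and> m + k \<in> N"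
    by (auto simp: monomial_ideal_def saturation_def)
  then obtain k where k: "\<And>m. m \<in> Poly_Mapping.keys f \<Longrightarrow> k m \<notin> meets C \<and> m + k m \<in> N" by metis
  \<comment> \<open>One multiplier has to serve all monomials of \<open>f\<close>. The sum of the
    individual ones still avoids \<open>C\<close>, and the surplus is harmless because
    \<open>N\<close> is upward closed.\<close>
  define l where "l = (\<Sum>m\<in>Poly_Mapping.keys f. k m)"
  have "l \<notin> meets C" using k by (auto simp: l_def meets_def lookup_sum)
  moreover have "l + m \<in> N" if m: "m \<in> Poly_Mapping.keys f" for m
  proof -
    have "l + m = (m + k m) + (\<Sum>m\<in>Poly_Mapping.keys f - {m}. k m)"
      unfolding l_def by (subst sum.remove[OF finite_keys m]) (simp add: ac_simps)
    then show ?thesis using up_closedD[OF N] k[OF m] by simp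
  qed
  then have "Poly_Mapping.single l 1 * f \<in> monomial_ideal N"
    using keys_mult[of "Poly_Mapping.single l 1" f] by (fastforce simp: monomial_ideal_def)
  ultimately show "f \<in> {f. \<exists>u. u \<notin> monomial_ideal (meets C) \<and> u * f \<in> monomial_ideal N}"
    by (auto simp: monomial_ideal_def intro!: exI[of _ "Poly_Mapping.single l 1"])
qed

text \<open>The set \<open>meets C\<close> is its own saturation at \<open>C\<close>, since a
  multiplier avoiding \<open>C\<close> cannot bring an exponent into it; cancellation then reads as
  primality.\<close>

lemma primeideal_meets:
  "primeideal (monomial_ideal (meets C) :: ('v::finite, 'k::field) mpoly set) mpoly_ring"
proof (rule primeidealI)
  show "ideal (monomial_ideal (meets C) :: ('v, 'k) mpoly set) mpoly_ring"
    by (intro ideal_monomial_ideal up_closed_meets)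
  show "cring (mpoly_ring :: ('v, 'k) mpoly ring)" by (rule cring_from_type_algebra)
  have "(1 :: ('v, 'k) mpoly) \<notin> monomial_ideal (meets C)" by (simp add: monomial_ideal_def meets_def)
  then show "carrier mpoly_ring \<noteq> (monomial_ideal (meets C) :: ('v, 'k) mpoly set)" by auto
  fix u f :: "('v, 'k) mpoly"
  assume "u \<otimes>\<^bsub>mpoly_ring\<^esub> f \<in> monomial_ideal (meets C)"
  moreover have "saturation C (meets C) = meets C"
    by (auto simp: saturation_def meets_add_iff) (auto simp: meets_def intro!: exI[of _ 0])
  ultimately show "u \<in> monomial_ideal (meets C) \<or> f \<in> monomial_ideal (meets C)"
    using saturation_cancel[OF up_closed_meets, of u C f C] by auto
qed

text \<open>The set of variables that multiply \<open>b + r\<close> into \<open>M\<close> can only grow with \<open>r\<close>; once its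
  cardinality is maximal, it is the required support.\<close>

lemma exists_prime_support:
  fixes M :: "('v::finite \<Rightarrow>\<^sub>0 nat) set"
  assumes M: "up_closed M" and b: "b \<notin> M"
  obtains C r where "\<And>k. b + r + k \<in> M \<longleftrightarrow> k \<in> meets C"
proof -
  define c where "c r = {x. b + r + Poly_Mapping.single x 1 \<in> M}" for r
  have "\<exists>r. b + r \<notin> M \<and> (\<forall>r'. b + r' \<notin> M \<longrightarrow> card (c r') \<le> card (c r))"
    using b by (intro ex_has_greatest_nat[where k = 0 and b = "Suc (card (UNIV :: 'v set))"])
      (auto simp: less_Suc_eq_le intro!: card_mono)
  then obtain r where r: "b + r \<notin> M" and max: "\<And>r'. b + r' \<notin> M \<Longrightarrow> card (c r') \<le> card (c r)" by blast
  have c_mono: "c r \<subseteq> c (r + k)" for k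
  proof
    fix x assume "x \<in> c r"
    then have "b + r + Poly_Mapping.single x 1 + k \<in> M" using up_closedD[OF M] by (simp add: c_def)
    then show "x \<in> c (r + k)" by (simp add: c_def ac_simps)
  qed
  have c_eq: "c (r + k) = c r" if "b + r + k \<notin> M" for k
    using max[of "r + k"] c_mono[of k] that
    by (metis add.assoc card_subset_eq finite le_antisym card_mono)
  have not_meets: "b + r + k \<notin> M" if "k \<notin> meets (c r)" for k
  proof -
    \<comment> \<open>Induction on the total degree of \<open>k\<close>. After one variable
      \<open>x\<close> is removed, the rest \<open>k'\<close> keeps \<open>b + r + k'\<close>
      outside \<open>M\<close>, so maximality gives \<open>c (r + k') = c r\<close>; as
      \<open>x\<close> is not in this set, putting it back does not lead into
      \<open>M\<close>.\<close>
    have "\<forall>k. k \<notin> meets (c r) \<longrightarrow> (\<Sum>x\<in>UNIV. Poly_Mapping.lookup k x) = n \<longrightarrow> b + r + k \<notin> M" for n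
    proof (induction n)
      case 0
      have "k = 0" if "(\<Sum>x\<in>UNIV. Poly_Mapping.lookup k x) = 0" for k :: "'v \<Rightarrow>\<^sub>0 nat"
        using that by (auto intro: poly_mapping_eqI)
      then show ?case using r by (metis add.right_neutral)
    next
      case (Suc n)
      show ?case
      proof (intro allI impI)
        fix k :: "'v \<Rightarrow>\<^sub>0 nat"
        assume k: "k \<notin> meets (c r)" "(\<Sum>x\<in>UNIV. Poly_Mapping.lookup k x) = Suc n"
        then obtain x where x: "Poly_Mapping.lookup k x \<noteq> 0"
          by (metis nat.distinct(1) sum.neutral)
        define k' where "k' = k - Poly_Mapping.single x 1"
        have kk': "k = k' + Poly_Mapping.single x 1"
          using x by (intro poly_mapping_eqI) (auto simp: k'_def lookup_add lookup_minus lookup_single when_def)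
        have "(\<Sum>y\<in>UNIV. Poly_Mapping.lookup (Poly_Mapping.single x (1::nat)) y) = 1"
          by (simp add: lookup_single when_def)
        then have "(\<Sum>x\<in>UNIV. Poly_Mapping.lookup k' x) = n"
          using k(2) unfolding kk' by (simp add: lookup_add sum.distrib)
        moreover have "k' \<notin> meets (c r)" using k(1) by (simp add: kk' meets_add_iff)
        ultimately have "c (r + k') = c r" using Suc.IH by (intro c_eq) blast
        moreover have "x \<notin> c r" using x k(1) by (auto simp: meets_def)
        ultimately show "b + r + k \<notin> M" by (auto simp: c_def kk' ac_simps)
      qed
    qed
    then show ?thesis using that by blast
  qed
  have "b + r + k \<in> M" if "k \<in> meets (c r)" for k
  proof -
    obtain x where x: "x \<in> c r" "Poly_Mapping.lookup k x \<noteq> 0" using \<open>k \<in> meets (c r)\<close> by (auto simp: meets_def)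
    have "k = Poly_Mapping.single x 1 + (k - Poly_Mapping.single x 1)"
      using x by (intro poly_mapping_eqI) (auto simp: lookup_add lookup_minus lookup_single when_def)
    then show ?thesis
      using up_closedD[OF M, of "b + r + Poly_Mapping.single x 1" "k - Poly_Mapping.single x 1"] x(1)
      by (simp add: c_def add.assoc)
  qed
  then show thesis using that not_meets by blast
qed

text \<open>The primes of the supports are associated and every associated prime lies below one of
  them. A multiplier outside the larger prime is also outside the smaller one, so the conditions at
  the supports imply all others.\<close>

lemma symbolic_power_monomial_ideal:
  fixes M N :: "('v::finite \<Rightarrow>\<^sub>0 nat) set"
  assumes M: "up_closed M" and N: "up_closed N"
    and pow: "ideal_power mpoly_ring (monomial_ideal M :: ('v, 'k::field) mpoly set) s = monomial_ideal N"
  shows "symbolic_power mpoly_ring (monomial_ideal M :: ('v, 'k) mpoly set) s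
    = monomial_ideal (\<Inter>C\<in>prime_supports M. saturation C N)"
proof -
  let ?I = "monomial_ideal M :: ('v, 'k) mpoly set"
  have sym: "symbolic_power mpoly_ring ?I s =
    {f. \<forall>P\<in>associated_primes mpoly_ring ?I. \<exists>u. u \<notin> P \<and> u * f \<in> monomial_ideal N}"
    using symbolic_power_eq[of ?I s] ideal_monomial_ideal[OF N, where 'k = 'k]
    unfolding pow by blast
  note ass = associated_primes_eq[OF ideal_monomial_ideal[OF M, where 'k = 'k]]
  have prime: "monomial_ideal (meets C) \<in> associated_primes mpoly_ring ?I"
    if C: "C \<in> prime_supports M" for C
  proof -
    obtain b where b: "\<And>k. b + k \<in> M \<longleftrightarrow> k \<in> meets C" using C by (auto simp: prime_supports_def)
    have "monomial_ideal (meets C) = {h. h * Poly_Mapping.single b 1 \<in> ?I}"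
    proof (intro equalityI subsetI CollectI)
      fix h :: "('v, 'k) mpoly" assume "h \<in> monomial_ideal (meets C)"
      then have "a + b \<in> M" if "a \<in> Poly_Mapping.keys h" for a
        using that b[of a] by (auto simp: monomial_ideal_def add.commute)
      then show "h * Poly_Mapping.single b 1 \<in> ?I"
        using keys_mult[of h "Poly_Mapping.single b 1"] by (fastforce simp: monomial_ideal_def)
    next
      fix h :: "('v, 'k) mpoly" assume h: "h \<in> {h. h * Poly_Mapping.single b 1 \<in> ?I}"
      show "h \<in> monomial_ideal (meets C)"
      proof (rule ccontr)
        assume "h \<notin> monomial_ideal (meets C)"
        \<comment> \<open>Cancelling \<open>h\<close> yields some \<open>k\<close> avoiding
          \<open>C\<close> with \<open>b + k \<in> M\<close>, against the choice of
          \<open>b\<close>.\<close>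
        then have "Poly_Mapping.single b (1 :: 'k) \<in> monomial_ideal (saturation C M)"
          using saturation_cancel[OF M] h by blast
        then show False using b by (auto simp: monomial_ideal_def saturation_def)
      qed
    qed
    then show ?thesis unfolding ass using primeideal_meets by blast
  qed
  have below: "\<exists>C\<in>prime_supports M. P \<subseteq> monomial_ideal (meets C)"
    if P: "P \<in> associated_primes mpoly_ring ?I" for P
  proof -
    obtain g where prime: "primeideal P mpoly_ring" and g: "P = {h. h * g \<in> ?I}"
      using P unfolding ass by blast
    \<comment> \<open>Otherwise the colon ideal is the whole ring. Hence \<open>g\<close> has a
      monomial \<open>b\<close> outside \<open>M\<close>, which some \<open>r\<close> moves to a
      prime support.\<close>
    have "g \<notin> ?I"
    proof
      assume "g \<in> ?I"
      then have "P = UNIV"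
        using g ideal_monomial_ideal[OF M] by (auto simp: ideal_ring_of_type_algebra_iff)
      then show False using primeideal.I_notcarr[OF prime] by simp
    qed
    then obtain b where b: "b \<in> Poly_Mapping.keys g" "b \<notin> M" by (auto simp: monomial_ideal_def)
    obtain C r where C: "\<And>k. b + r + k \<in> M \<longleftrightarrow> k \<in> meets C" using exists_prime_support[OF M b(2)] by blast
    have "h \<in> monomial_ideal (meets C)" if "h * g \<in> ?I" for h
    proof (rule ccontr)
      assume "h \<notin> monomial_ideal (meets C)"
      then have "g \<in> monomial_ideal (saturation C M)" using saturation_cancel[OF M] that by blast
      then obtain k where "k \<notin> meets C" "b + k \<in> M" using b by (auto simp: monomial_ideal_def saturation_def)
      then show False using C[of k] up_closedD[OF M, of "b + k" r] by (simp add: ac_simps)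
    qed
    moreover have "C \<in> prime_supports M" using C by (auto simp: prime_supports_def)
    ultimately show ?thesis using g by blast
  qed
  have "symbolic_power mpoly_ring ?I s = {f. \<forall>C\<in>prime_supports M.
      \<exists>u. u \<notin> monomial_ideal (meets C) \<and> u * f \<in> monomial_ideal N}"
    unfolding sym using prime below by blast
  also have "\<dots> = {f. \<forall>C\<in>prime_supports M. f \<in> monomial_ideal (saturation C N)}"
    using saturation_eq[OF N, where 'k = 'k] by blast
  also have "\<dots> = monomial_ideal (\<Inter>C\<in>prime_supports M. saturation C N)"
    by (auto simp: monomial_ideal_def)
  finally show ?thesis .
qed

section \<open>Extension along a substitution of powers\<close>

definition scale :: "('v::finite \<Rightarrow> nat) \<Rightarrow> ('v \<Rightarrow>\<^sub>0 nat) \<Rightarrow> 'v \<Rightarrow>\<^sub>0 nat" where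
  "scale c m = Abs_poly_mapping (\<lambda>x. c x * Poly_Mapping.lookup m x)"

text \<open>For positive \<open>c\<close> this is the largest exponent whose scaling is bounded by
  \<open>m\<close>. So, for upward closed \<open>M\<close>, \<open>m\<close> lies above a scaled
  element of \<open>M\<close> exactly if \<open>descale c m \<in> M\<close>.\<close>

definition descale :: "('v::finite \<Rightarrow> nat) \<Rightarrow> ('v \<Rightarrow>\<^sub>0 nat) \<Rightarrow> 'v \<Rightarrow>\<^sub>0 nat" where
  "descale c m = Abs_poly_mapping (\<lambda>x. Poly_Mapping.lookup m x div c x)"

lemma lookup_scale [simp]: "Poly_Mapping.lookup (scale c m) x = c x * Poly_Mapping.lookup m x"
  and lookup_descale [simp]: "Poly_Mapping.lookup (descale c m) x = Poly_Mapping.lookup m x div c x"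
  by (simp_all add: scale_def descale_def)

lemma Var_power: "(Var x :: ('v, 'k::field) mpoly) ^ n = Poly_Mapping.single (Poly_Mapping.single x n) 1"
  by (induction n) (simp_all add: Var_def mult_single flip: single_add)

lemma prod_single_one:
  "(\<Prod>x\<in>A. Poly_Mapping.single (e x) (1 :: 'k::field)) = Poly_Mapping.single (\<Sum>x\<in>A. e x) 1"
  by (induction A rule: infinite_finite_induct) (simp_all add: mult_single)

lemma prod_Var_power:
  fixes m :: "'v::finite \<Rightarrow>\<^sub>0 nat"
  shows "(\<Prod>x\<in>UNIV. Var x ^ Poly_Mapping.lookup m x) = Poly_Mapping.single m (1 :: 'k::field)"
proof -
  have "(\<Sum>x\<in>UNIV. Poly_Mapping.single x (Poly_Mapping.lookup m x)) = m"
    by (rule poly_mapping_eqI) (simp add: lookup_sum lookup_single when_def)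
  then show ?thesis by (simp add: Var_power prod_single_one)
qed

section \<open>Preimages of exponent sets under floor division\<close>

context
  fixes c :: "'v::finite \<Rightarrow> nat"
  assumes pos: "c x > 0"
begin

text \<open>Adding multiples of \<open>c\<close> causes no carry, so any prescribed increase of the
  quotient can be lifted.\<close>

lemma descale_add_scale: "descale c (m + scale c k) = descale c m + k"
  using pos by (intro poly_mapping_eqI) (simp add: lookup_add)

lemma up_closed_descale:
  assumes "up_closed M"
  shows "up_closed (descale c -` M)"
  unfolding up_closed_def
proof (intro ballI allI)
  fix m k assume "m \<in> descale c -` M"
  \<comment> \<open>Subtraction is truncated; monotonicity of floor division makes it exact
    here.\<close>
  moreover have "descale c (m + k) = descale c m + (descale c (m + k) - descale c m)"
    by (intro poly_mapping_eqI) (simp add: lookup_add lookup_minus div_le_mono)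
  ultimately show "m + k \<in> descale c -` M" using up_closedD[OF assms] by (metis vimageE vimageI2)
qed

lemma prime_supports_descale: "prime_supports (descale c -` M) = prime_supports M"
proof (intro equalityI subsetI)
  fix C assume "C \<in> prime_supports M"
  then obtain b where b: "\<And>k. b + k \<in> M \<longleftrightarrow> k \<in> meets C" by (auto simp: prime_supports_def)
  \<comment> \<open>The largest exponent with quotient \<open>b\<close>: with remainder
    \<open>c x - 1\<close> everywhere, raising a coordinate by one already raises its
    quotient.\<close>
  define b' where "b' = Abs_poly_mapping (\<lambda>x. c x * Poly_Mapping.lookup b x + (c x - 1))"
  have lookup_b': "Poly_Mapping.lookup b' x = c x * Poly_Mapping.lookup b x + (c x - 1)" for x
    by (simp add: b'_def)
  have "b' + k \<in> descale c -` M \<longleftrightarrow> k \<in> meets C" for k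
  proof -
    \<comment> \<open>This is \<open>k\<close> divided by \<open>c\<close> and rounded up, so it
      vanishes exactly where \<open>k\<close> does.\<close>
    define l where "l = Abs_poly_mapping (\<lambda>x. (c x - 1 + Poly_Mapping.lookup k x) div c x)"
    have lookup_l: "Poly_Mapping.lookup l x = (c x - 1 + Poly_Mapping.lookup k x) div c x" for x
      by (simp add: l_def)
    have "descale c (b' + k) = b + l"
      using pos by (intro poly_mapping_eqI) (simp add: lookup_add lookup_b' lookup_l add.assoc)
    moreover have "Poly_Mapping.lookup l x = 0 \<longleftrightarrow> Poly_Mapping.lookup k x = 0" for x
      using pos[of x] by (auto simp: lookup_l div_eq_0_iff)
    then have "l \<in> meets C \<longleftrightarrow> k \<in> meets C" unfolding meets_def mem_Collect_eq by metis
    ultimately show ?thesis by (simp add: b)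
  qed
  then show "C \<in> prime_supports (descale c -` M)" by (auto simp: prime_supports_def)
next
  fix C assume "C \<in> prime_supports (descale c -` M)"
  then obtain b where b: "\<And>k. b + k \<in> descale c -` M \<longleftrightarrow> k \<in> meets C" by (auto simp: prime_supports_def)
  \<comment> \<open>Test the property of \<open>b\<close> on scaled exponents: scaling by positive
    factors keeps the support.\<close>
  have "descale c b + k \<in> M \<longleftrightarrow> k \<in> meets C" for k
  proof -
    have "scale c k \<in> meets C \<longleftrightarrow> k \<in> meets C" using pos by (auto simp: meets_def)
    then show ?thesis using b[of "scale c k"] by (simp add: descale_add_scale)
  qed
  then show "C \<in> prime_supports M" by (auto simp: prime_supports_def)
qed

text \<open>Adding \<open>k\<close> raises the quotient only in coordinates where \<open>k\<close>
  is nonzero, so the increase avoids \<open>C\<close> when \<open>k\<close> does. Conversely, a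
  multiplier for the quotient lifts by scaling.\<close>

lemma saturation_descale: "saturation C (descale c -` N) = descale c -` saturation C N"
proof (intro equalityI subsetI)
  fix m assume "m \<in> saturation C (descale c -` N)"
  then obtain k where k: "k \<notin> meets C" "descale c (m + k) \<in> N" by (auto simp: saturation_def)
  define l where "l = descale c (m + k) - descale c m"
  have "descale c (m + k) = descale c m + l"
    unfolding l_def by (intro poly_mapping_eqI) (simp add: lookup_add lookup_minus div_le_mono)
  moreover have "l \<notin> meets C" using k by (auto simp: l_def meets_def lookup_minus lookup_add)
  ultimately show "m \<in> descale c -` saturation C N" using k by (auto simp: saturation_def)
next
  fix m assume "m \<in> descale c -` saturation C N"
  then obtain k where k: "k \<notin> meets C" "descale c m + k \<in> N" by (auto simp: saturation_def)
  then have "scale c k \<notin> meets C" "descale c (m + scale c k) \<in> N"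
    by (auto simp: meets_def descale_add_scale)
  then show "m \<in> saturation C (descale c -` N)" by (auto simp: saturation_def)
qed

end

section \<open>Extension of ideals along an algebra homomorphism\<close>

context
  fixes \<Phi> :: "('v::finite, 'k::field) mpoly \<Rightarrow> ('v, 'k) mpoly"
  assumes hom: "is_algebra_hom \<Phi>"
begin

lemma algebra_hom_simps:
  "\<Phi> (f * g) = \<Phi> f * \<Phi> g" "\<Phi> (f + g) = \<Phi> f + \<Phi> g" "\<Phi> 1 = 1" "\<Phi> 0 = 0"
proof -
  have h: "\<Phi> \<in> ring_hom mpoly_ring mpoly_ring" using hom by (simp add: is_algebra_hom_def)
  show "\<Phi> (f * g) = \<Phi> f * \<Phi> g" "\<Phi> 1 = 1"
    using ring_hom_mult[OF h] ring_hom_one[OF h] by simp_all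
  show add: "\<Phi> (f + g) = \<Phi> f + \<Phi> g" for f g
    using ring_hom_add[OF h] by simp
  show "\<Phi> 0 = 0" using add[of 0 0] by simp
qed

lemma algebra_hom_power: "\<Phi> (f ^ n) = \<Phi> f ^ n"
  by (induction n) (simp_all add: algebra_hom_simps)

lemma algebra_hom_prod: "\<Phi> (\<Prod>x\<in>A. h x) = (\<Prod>x\<in>A. \<Phi> (h x))"
  by (induction A rule: infinite_finite_induct) (simp_all add: algebra_hom_simps)

lemma ideal_vimage: "ideal J mpoly_ring \<Longrightarrow> ideal (\<Phi> -` J) mpoly_ring"
  by (simp add: ideal_ring_of_type_algebra_iff algebra_hom_simps)

lemma ideal_extension_facts:
  shows ideal_ideal_extension: "ideal (ideal_extension \<Phi> I) mpoly_ring"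
    and mem_ideal_extension: "f \<in> I \<Longrightarrow> \<Phi> f \<in> ideal_extension \<Phi> I"
    and ideal_extension_minimal:
      "ideal J mpoly_ring \<Longrightarrow> (\<And>f. f \<in> I \<Longrightarrow> \<Phi> f \<in> J) \<Longrightarrow> ideal_extension \<Phi> I \<subseteq> J"
  unfolding ideal_extension_def
  using genideal_type_algebra(1,2)[where A = "\<Phi> ` I"] genideal_type_algebra(3)[of J "\<Phi> ` I"]
  by blast+

lemma ideal_extension_genideal:
  "ideal_extension \<Phi> (Idl\<^bsub>mpoly_ring\<^esub> A) = Idl\<^bsub>mpoly_ring\<^esub> (\<Phi> ` A)"
proof
  note A = genideal_type_algebra[where A = A] and \<Phi>A = genideal_type_algebra[where A = "\<Phi> ` A"]
  have "Idl\<^bsub>mpoly_ring\<^esub> A \<subseteq> \<Phi> -` (Idl\<^bsub>mpoly_ring\<^esub> (\<Phi> ` A))"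
    by (intro A(3) ideal_vimage \<Phi>A(1)) (use \<Phi>A(2) in auto)
  then show "ideal_extension \<Phi> (Idl\<^bsub>mpoly_ring\<^esub> A) \<subseteq> Idl\<^bsub>mpoly_ring\<^esub> (\<Phi> ` A)"
    by (intro ideal_extension_minimal \<Phi>A(1)) auto
  show "Idl\<^bsub>mpoly_ring\<^esub> (\<Phi> ` A) \<subseteq> ideal_extension \<Phi> (Idl\<^bsub>mpoly_ring\<^esub> A)"
    by (intro \<Phi>A(3) ideal_ideal_extension) (use A(2) mem_ideal_extension in auto)
qed

text \<open>For the inclusion from right to left, elements generated by images have to be
  multiplied. The partners of a fixed factor whose product lands on the left form an ideal, so it is
  enough to test generators, in one factor at a time.\<close>

lemma ideal_extension_ideal_prod:
  assumes "ideal I mpoly_ring" "ideal J mpoly_ring"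
  shows "ideal_extension \<Phi> (I \<cdot>\<^bsub>mpoly_ring\<^esub> J) = ideal_extension \<Phi> I \<cdot>\<^bsub>mpoly_ring\<^esub> ideal_extension \<Phi> J"
    (is "?L = ?R")
proof
  have R: "ideal ?R mpoly_ring"
    by (intro ring.ideal_prod_is_ideal ring_from_type_algebra ideal_ideal_extension)
  show "?L \<subseteq> ?R"
  proof (rule ideal_extension_minimal[OF R])
    fix f assume "f \<in> I \<cdot>\<^bsub>mpoly_ring\<^esub> J"
    then show "\<Phi> f \<in> ?R"
    proof induction
      case (prod i j)
      then show ?case
        using ideal_prod.prod[OF mem_ideal_extension[OF prod(1)] mem_ideal_extension[OF prod(2)], of mpoly_ring]
        by (simp add: algebra_hom_simps)
    next
      case (sum f g)
      then show ?case using R by (simp add: ideal_ring_of_type_algebra_iff algebra_hom_simps)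
    qed
  qed
  note L = ideal_ideal_extension[of "I \<cdot>\<^bsub>mpoly_ring\<^esub> J"]
  note L' = L[unfolded ideal_ring_of_type_algebra_iff]
  have "\<Phi> i * \<Phi> j \<in> ?L" if "i \<in> I" "j \<in> J" for i j
    using mem_ideal_extension[OF ideal_prod.prod[OF that, of mpoly_ring]] by (simp add: algebra_hom_simps)
  moreover have "ideal {g. f * g \<in> ?L} mpoly_ring" for f
    using L' by (auto simp: ideal_ring_of_type_algebra_iff distrib_left mult.left_commute[of f])
  ultimately have "ideal_extension \<Phi> J \<subseteq> {g. \<Phi> i * g \<in> ?L}" if "i \<in> I" for i
    using that by (intro ideal_extension_minimal) auto
  moreover have "ideal {f. \<forall>g\<in>ideal_extension \<Phi> J. f * g \<in> ?L} mpoly_ring"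
    using L' by (auto simp: ideal_ring_of_type_algebra_iff distrib_right mult.assoc)
  ultimately have "ideal_extension \<Phi> I \<subseteq> {f. \<forall>g\<in>ideal_extension \<Phi> J. f * g \<in> ?L}"
    by (intro ideal_extension_minimal) auto
  then have mult: "f * g \<in> ?L" if "f \<in> ideal_extension \<Phi> I" "g \<in> ideal_extension \<Phi> J" for f g
    using that by blast
  show "?R \<subseteq> ?L"
  proof
    fix f assume "f \<in> ?R"
    then show "f \<in> ?L" by induction (use mult L' in simp_all)
  qed
qed

lemma ideal_extension_ideal_power:
  assumes I: "ideal I mpoly_ring"
  shows "ideal_extension \<Phi> (ideal_power mpoly_ring I s) = ideal_power mpoly_ring (ideal_extension \<Phi> I) s"
proof -
  \<comment> \<open>The induction carries along that the power is an ideal, which the product rule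
    requires.\<close>
  have "ideal (ideal_power mpoly_ring I s) mpoly_ring \<and>
    ideal_extension \<Phi> (ideal_power mpoly_ring I s) = ideal_power mpoly_ring (ideal_extension \<Phi> I) s"
  proof (induction s)
    case 0
    have "1 \<in> ideal_extension \<Phi> UNIV"
      using mem_ideal_extension[of 1 UNIV] by (simp add: algebra_hom_simps)
    then have "f * 1 \<in> ideal_extension \<Phi> UNIV" for f
      using ideal_ideal_extension[of UNIV] unfolding ideal_ring_of_type_algebra_iff by blast
    then have "ideal_extension \<Phi> UNIV = UNIV" by auto
    then show ?case
      unfolding ideal_power_simps ring_of_type_algebra_simps by (simp add: ideal_ring_of_type_algebra_iff)
  next
    case (Suc s)
    then show ?case
      unfolding ideal_power_simps
      using ring.ideal_prod_is_ideal[OF ring_from_type_algebra _ I] ideal_extension_ideal_prod[OF _ I] by simp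
  qed
  then show ?thesis by blast
qed

section \<open>Homomorphisms sending each variable to a power of itself\<close>

context
  fixes c :: "'v \<Rightarrow> nat"
  assumes pos: "c x > 0" and hom_Var: "\<Phi> (Var x) = Var x ^ c x"
begin

lemma algebra_hom_single: "\<Phi> (Poly_Mapping.single m 1) = Poly_Mapping.single (scale c m) 1"
  by (simp add: algebra_hom_prod algebra_hom_power hom_Var power_mult flip: prod_Var_power)

lemma ideal_extension_monomial_ideal:
  assumes M: "up_closed M"
  shows "ideal_extension \<Phi> (monomial_ideal M) = monomial_ideal (descale c -` M)"
proof
  note I = ideal_monomial_ideal[OF up_closed_descale[OF pos M], where 'k = 'k]
  have "scale c m \<in> descale c -` M" if "m \<in> M" for m
    using descale_add_scale[OF pos, where m = 0 and k = m] that by (simp add: descale_def)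
  then have "monomial_ideal M \<subseteq> \<Phi> -` monomial_ideal (descale c -` M)"
    unfolding monomial_ideal_subset_iff[OF ideal_vimage[OF I]]
    by (auto simp: algebra_hom_single intro!: single_mem_monomial_ideal)
  then show "ideal_extension \<Phi> (monomial_ideal M) \<subseteq> monomial_ideal (descale c -` M)"
    by (intro ideal_extension_minimal I) auto
  have "Poly_Mapping.single m 1 \<in> ideal_extension \<Phi> (monomial_ideal M)" if "descale c m \<in> M" for m
  proof -
    \<comment> \<open>Division with remainder in each coordinate: the monomial of \<open>m\<close>
      is a multiple of the image of the monomial of its quotient.\<close>
    have "m = (m - scale c (descale c m)) + scale c (descale c m)"
      by (intro poly_mapping_eqI) (simp add: lookup_add lookup_minus)
    then have "Poly_Mapping.single m 1 =
      Poly_Mapping.single (m - scale c (descale c m)) 1 * \<Phi> (Poly_Mapping.single (descale c m) 1)"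
      by (simp add: algebra_hom_single mult_single)
    then show ?thesis
      using mem_ideal_extension[OF single_mem_monomial_ideal[OF that]]
        ideal_ideal_extension[of "monomial_ideal M"]
      unfolding ideal_ring_of_type_algebra_iff by metis
  qed
  then show "monomial_ideal (descale c -` M) \<subseteq> ideal_extension \<Phi> (monomial_ideal M)"
    unfolding monomial_ideal_subset_iff[OF ideal_ideal_extension] by auto
qed

text \<open>Ordinary power, saturations and their intersection all turn into preimages under
  \<open>descale c\<close>, and the index set of supports is the same for both ideals.\<close>

lemma ideal_extension_symbolic_power:
  assumes M: "up_closed M"
  shows "ideal_extension \<Phi> (symbolic_power mpoly_ring (monomial_ideal M) s)
    = symbolic_power mpoly_ring (ideal_extension \<Phi> (monomial_ideal M)) s"
proof -
  obtain N where N: "up_closed N" "ideal_power mpoly_ring (monomial_ideal M :: ('v, 'k) mpoly set) s = monomial_ideal N"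
    using ideal_power_monomial_ideal[OF M] by blast
  let ?N = "\<Inter>C\<in>prime_supports M. saturation C N"
  have pow: "ideal_power mpoly_ring (monomial_ideal (descale c -` M) :: ('v, 'k) mpoly set) s
      = monomial_ideal (descale c -` N)"
    using ideal_extension_ideal_power[OF ideal_monomial_ideal[OF M], of s]
    by (simp add: N ideal_extension_monomial_ideal M)
  have "up_closed ?N"
    using up_closed_saturation[OF N(1)] by (auto simp: up_closed_def)
  then have "ideal_extension \<Phi> (symbolic_power mpoly_ring (monomial_ideal M) s)
    = monomial_ideal (descale c -` ?N)"
    by (simp add: symbolic_power_monomial_ideal[OF M N] ideal_extension_monomial_ideal)
  also have "descale c -` ?N
      = (\<Inter>C\<in>prime_supports (descale c -` M). saturation C (descale c -` N))"
    by (auto simp: prime_supports_descale[OF pos] saturation_descale[OF pos])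
  also have "monomial_ideal \<dots> = symbolic_power mpoly_ring (monomial_ideal (descale c -` M) :: ('v, 'k) mpoly set) s"
    by (intro symbolic_power_monomial_ideal[symmetric] up_closed_descale pos M N pow)
  finally show ?thesis by (simp add: ideal_extension_monomial_ideal M)
qed

end

end

section \<open>Edge ideals as monomial ideals and the effect of the substitution on them\<close>

lemma edge_ideal_monomial:
  "\<exists>M. up_closed M \<and> (edge_ideal D :: ('v::finite, 'k::field) mpoly set) = monomial_ideal M"
proof -
  let ?E = "{Poly_Mapping.single x 1 + Poly_Mapping.single y (weight D y) | x y. (x, y) \<in> edges D}"
  have "{Var x * Var y ^ weight D y | x y. (x, y) \<in> edges D}
      = (\<lambda>e. Poly_Mapping.single e (1 :: 'k)) ` ?E"
  proof -
    have "Var x * Var y ^ weight D y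
        = Poly_Mapping.single (Poly_Mapping.single x 1 + Poly_Mapping.single y (weight D y)) (1 :: 'k)" for x y
      unfolding Var_power by (simp add: Var_def mult_single)
    then show ?thesis by (simp only: image_Collect) metis
  qed
  then have "(edge_ideal D :: ('v, 'k) mpoly set) = monomial_ideal {e + k | e k. e \<in> ?E}"
    unfolding edge_ideal_def using genideal_monomials[of ?E, where 'k = 'k] by simp
  moreover have "up_closed {e + k | e k. e \<in> ?E}"
    unfolding up_closed_def by (clarsimp, metis add.assoc)
  ultimately show ?thesis by blast
qed

theorem theorem4p4:
  fixes D D' :: "'v::finite wograph"
    and U :: "'v set"
    and \<Phi> :: "('v, 'k::field) mpoly \<Rightarrow> ('v, 'k) mpoly"
    and s :: nat
  assumes "weighted_oriented_graph D"
    and "U = {x \<in> nontrivial_weight_verts D. is_sink D x}"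
    and "D' = D\<lparr>weight := (\<lambda>x. if x \<in> U then 1 else weight D x)\<rparr>"
    and "is_algebra_hom \<Phi>"
    and "\<And>x. x \<notin> U \<Longrightarrow> \<Phi> (Var x) = Var x"
    and "\<And>x. x \<in> U \<Longrightarrow> \<Phi> (Var x) = Var x ^ weight D x"
    and "s \<ge> 1"
  shows "ideal_extension \<Phi> (ideal_power mpoly_ring (edge_ideal D') s)
           = ideal_power mpoly_ring (edge_ideal D) s
       \<and> ideal_extension \<Phi> (symbolic_power mpoly_ring (edge_ideal D') s)
           = symbolic_power mpoly_ring (edge_ideal D) s"
proof -
  \<comment> \<open>The exponent \<open>1\<close> off \<open>U\<close> brings both cases of
    \<open>\<Phi>\<close> into one formula.\<close>
  define c where "c x = (if x \<in> U then weight D x else 1)" for x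
  have "weight D x \<ge> 1" for x using assms(1) by (simp add: weighted_oriented_graph_def)
  then have pos: "c x > 0" for x by (simp add: c_def Suc_le_eq)
  have \<Phi>_Var: "\<Phi> (Var x) = Var x ^ c x" for x using assms(5,6) by (simp add: c_def)
  \<comment> \<open>A sink on an edge is its head, and an edge has distinct ends.\<close>
  have tail: "x \<notin> U" if "(x, y) \<in> edges D" for x y
    using that assms(1) by (fastforce simp: assms(2) is_sink_def weighted_oriented_graph_def)
  \<comment> \<open>If \<open>y \<in> U\<close>, the weight in \<open>D'\<close> is \<open>1\<close>
    and \<open>\<Phi>\<close> supplies the power; otherwise the weights agree and
    \<open>\<Phi>\<close> fixes both variables.\<close>
  have gen: "\<Phi> (Var x * Var y ^ weight D' y) = Var x * Var y ^ weight D y" if "(x, y) \<in> edges D" for x y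
    using tail[OF that] assms(3,5,6)
    by (cases "y \<in> U") (simp_all add: algebra_hom_simps[OF assms(4)] algebra_hom_power[OF assms(4)])
  have "edges D' = edges D" using assms(3) by simp
  then have "\<Phi> ` {Var x * Var y ^ weight D' y | x y. (x, y) \<in> edges D'}
      = {Var x * Var y ^ weight D y | x y. (x, y) \<in> edges D}"
    using gen by (force simp: image_iff)
  then have ext: "ideal_extension \<Phi> (edge_ideal D') = edge_ideal D"
    by (simp add: edge_ideal_def ideal_extension_genideal[OF assms(4)])
  obtain M where M: "up_closed M" "edge_ideal D' = (monomial_ideal M :: ('v, 'k) mpoly set)"
    using edge_ideal_monomial by blast
  show ?thesis
    using ideal_extension_ideal_power[OF assms(4) ideal_monomial_ideal[OF M(1)]]
      ideal_extension_symbolic_power[OF assms(4) pos \<Phi>_Var M(1)] ext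
    unfolding M(2) by simp
qed

end
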